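(* Let $K\ge1$ be an integer with $K\equiv 0\pmod 4$, and let $p_1^{a_1}p_2^{a_2}\cdots p_r^{a_r}$ be the prime factorization of $K^2+4$, where $p_1^{a_1}=2^2$. If $m>1$ is an integer with $\pi_K(m)=m$, then either $m=2$ or $m=4\cdot p_2^{j_2}\cdots p_r^{j_r}$ for some integers $j_2,\dots,j_r\ge0$.
   Context: The $K$-Fibonacci sequence is $F_{K,0}=0$, $F_{K,1}=1$, $F_{K,n}=K F_{K,n-1}+F_{K,n-2}$; for an integer $m>1$, $\pi_K(m)$ is the length of its shortest period modulo $m$. *)

theory Defs
  imports "HOL-Number_Theory.Number_Theory"
begin

fun kfib :: "nat \<Rightarrow> nat \<Rightarrow> nat" where
  "kfib K 0 = 0"
| "kfib K (Suc 0) = 1"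
| "kfib K (Suc (Suc n)) = K * kfib K (Suc n) + kfib K n"

text \<open>
  The recurrence is invertible modulo \<open>m\<close>, so for \<open>m > 0\<close> the sequence is purely periodic
  and the least element below exists; there is no preperiod to allow for.
\<close>

definition kfib_period :: "nat \<Rightarrow> nat \<Rightarrow> nat" where
  "kfib_period K m = (LEAST t. t > 0 \<and> (\<forall>n. [kfib K (n + t) = kfib K n] (mod m)))"

end

theory Submission
  imports Defs Complex_Main
begin

text \<open>
  Put \<open>D = K\<^sup>2 + 4\<close>. Modulo an odd prime \<open>p\<close> dividing \<open>D\<close> the characteristic polynomial has
  the double root \<open>K/2\<close>, so \<open>4p\<close> is a period and every period is divisible by 4. For
  a prime \<open>p\<close> not dividing \<open>D\<close>, \<open>p\<^sup>2 - 1\<close> is a period. A period \<open>t\<close> modulo \<open>p\<close> lifts to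
  the period \<open>t p\<^bsup>e-1\<^esup>\<close> modulo \<open>p\<^sup>e\<close>, and 2 is a period modulo 4.

  Let \<open>m\<close> be its own period, so that \<open>m\<close> divides each of its periods. If \<open>q\<close> is the largest prime
  factor of \<open>m\<close> not dividing \<open>D\<close>, then \<open>q\<close> divides none of the numbers \<open>4p\<close> or \<open>p\<^sup>2 - 1\<close>
  above, and the product of the lifted periods has one factor \<open>q\<close> too few. So all prime factors of
  \<open>m\<close> divide \<open>D\<close>. An odd one forces 4 to divide \<open>m\<close>; and if 8 divides \<open>m\<close>, then \<open>m/2\<close> is
  already a period.
\<close>

section \<open>Periods and the least period modulo m\<close>

text \<open>Zero counts as a period, so periods are closed under all multiples; positivity is
  required separately.\<close>

definition is_kfib_period :: "nat \<Rightarrow> nat \<Rightarrow> nat \<Rightarrow> bool" where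
  "is_kfib_period K m t \<longleftrightarrow> (\<forall>n. [kfib K (n + t) = kfib K n] (mod m))"

text \<open>A second-order recurrence carries agreement of two consecutive terms onwards, so it
  suffices to compare with the initial pair 0, 1.\<close>

lemma is_kfib_period_iff:
  "is_kfib_period K m t \<longleftrightarrow> [kfib K t = 0] (mod m) \<and> [kfib K (Suc t) = 1] (mod m)"
proof
  assume "is_kfib_period K m t"
  then show "[kfib K t = 0] (mod m) \<and> [kfib K (Suc t) = 1] (mod m)"
    unfolding is_kfib_period_def by (metis add_0 kfib.simps(1,2) plus_1_eq_Suc One_nat_def)
next
  assume *: "[kfib K t = 0] (mod m) \<and> [kfib K (Suc t) = 1] (mod m)"
  have "[kfib K (n + t) = kfib K n] (mod m) \<and> [kfib K (Suc n + t) = kfib K (Suc n)] (mod m)" for n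
  proof (induction n)
    case 0
    then show ?case using * by simp
  next
    case (Suc n)
    then have "[K * kfib K (Suc n + t) + kfib K (n + t) = K * kfib K (Suc n) + kfib K n] (mod m)"
      by (intro cong_add cong_mult) auto
    then show ?case using Suc by simp
  qed
  then show "is_kfib_period K m t" unfolding is_kfib_period_def by blast
qed

lemma is_kfib_period_add:
  assumes "is_kfib_period K m s" "is_kfib_period K m t"
  shows "is_kfib_period K m (s + t)"
  unfolding is_kfib_period_def
proof
  fix n
  have "[kfib K (n + s + t) = kfib K (n + s)] (mod m)" "[kfib K (n + s) = kfib K n] (mod m)"
    using assms unfolding is_kfib_period_def by blast+
  then show "[kfib K (n + (s + t)) = kfib K n] (mod m)"
    by (metis add.assoc cong_trans)
qed

lemma is_kfib_period_mult:
  "is_kfib_period K m t \<Longrightarrow> is_kfib_period K m (k * t)"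
proof (induction k)
  case 0
  then show ?case by (simp add: is_kfib_period_def)
next
  case (Suc k)
  then show ?case using is_kfib_period_add[of K m t "k * t"] by simp
qed

lemma is_kfib_period_dvd:
  "is_kfib_period K m s \<Longrightarrow> s dvd t \<Longrightarrow> is_kfib_period K m t"
  using is_kfib_period_mult by (metis dvd_def mult.commute)

lemma is_kfib_period_dvd_modulus:
  "is_kfib_period K m t \<Longrightarrow> d dvd m \<Longrightarrow> is_kfib_period K d t"
  unfolding is_kfib_period_def by (meson cong_dvd_modulus_nat)

lemma kfib_period_is_period:
  assumes "is_kfib_period K m t" "t > 0"
  shows "kfib_period K m > 0" "is_kfib_period K m (kfib_period K m)"
proof -
  have "kfib_period K m > 0 \<and> (\<forall>n. [kfib K (n + kfib_period K m) = kfib K n] (mod m))"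
    unfolding kfib_period_def by (rule LeastI[of _ t]) (use assms is_kfib_period_def in auto)
  then show "kfib_period K m > 0" "is_kfib_period K m (kfib_period K m)"
    by (auto simp: is_kfib_period_def)
qed

text \<open>Division with remainder: \<open>t mod kfib_period K m\<close> is again a period and lies
  below the least positive one, hence is 0.\<close>

lemma kfib_period_dvd:
  assumes "is_kfib_period K m t" "t > 0"
  shows "kfib_period K m dvd t"
proof (rule ccontr)
  let ?P = "kfib_period K m"
  let ?r = "t mod ?P"
  assume "\<not> ?P dvd t"
  then have r: "?r > 0" by (simp add: mod_greater_zero_iff_not_dvd)
  have P: "?P > 0" "is_kfib_period K m ?P"
    using kfib_period_is_period[OF assms] by auto
  have "is_kfib_period K m ?r"
    unfolding is_kfib_period_def
  proof
    fix n
    have "[kfib K (n + ?r + t div ?P * ?P) = kfib K (n + ?r)] (mod m)"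
      using is_kfib_period_mult[OF P(2)] unfolding is_kfib_period_def by blast
    moreover have "n + ?r + t div ?P * ?P = n + t" by (simp add: mod_div_mult_eq)
    moreover have "[kfib K (n + t) = kfib K n] (mod m)"
      using assms unfolding is_kfib_period_def by blast
    ultimately show "[kfib K (n + ?r) = kfib K n] (mod m)"
      by (metis cong_sym cong_trans)
  qed
  then have "?P \<le> ?r"
    unfolding kfib_period_def[of K m, folded is_kfib_period_def]
    using r by (intro Least_le) (auto simp: kfib_period_def is_kfib_period_def)
  then show False using P(1) mod_less_divisor[of ?P t] by linarith
qed

section \<open>Addition formula, lifting to prime powers, gluing of coprime moduli\<close>

text \<open>Upper left entry of M^(m+n) = M^m M^n for the companion matrix M with rows (K, 1) and
  (1, 0).\<close>

lemma kfib_add: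
  "kfib K (Suc (m + n)) = kfib K (Suc m) * kfib K (Suc n) + kfib K m * kfib K n"
proof (induction n rule: less_induct)
  case (less n)
  consider "n = 0" | "n = 1" | l where "n = Suc (Suc l)"
    by (metis One_nat_def not0_implies_Suc)
  then show ?case
  proof cases
    case 3
    have "kfib K (Suc (m + n)) = K * kfib K (Suc (m + Suc l)) + kfib K (Suc (m + l))"
      using 3 by simp
    also have "\<dots> = K * (kfib K (Suc m) * kfib K (Suc (Suc l)) + kfib K m * kfib K (Suc l))
        + (kfib K (Suc m) * kfib K (Suc l) + kfib K m * kfib K l)"
      using less[of l] less[of "Suc l"] 3 by (simp del: kfib.simps)
    also have "\<dots> = kfib K (Suc m) * kfib K (Suc n) + kfib K m * kfib K n"
      unfolding 3 by (simp add: algebra_simps)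
    finally show ?thesis .
  qed (auto simp: algebra_simps)
qed

text \<open>Writing the companion matrix power as \<open>I + n X\<close>, its \<open>p\<close>-th power is
  \<open>I + p n X\<close> modulo \<open>n\<^sup>2\<close>.\<close>

lemma is_kfib_period_lift:
  assumes per: "is_kfib_period K n t" and "p dvd n"
  shows "is_kfib_period K (n * p) (t * p)"
proof -
  define A where "A k = int (kfib K (k * t))" for k
  define B where "B k = int (kfib K (Suc (k * t)))" for k
  obtain x y where x: "A 1 = int n * x" and y: "B 1 = 1 + int n * y"
  proof -
    have "[A 1 = 0] (mod int n)" "[B 1 = 1] (mod int n)"
      using per unfolding is_kfib_period_iff A_def B_def
      by (auto simp flip: cong_int_iff)
    then have "int n dvd A 1" "int n dvd B 1 - 1"
      by (auto simp: cong_0_iff cong_iff_dvd_diff)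
    then obtain u v where "A 1 = int n * u" "B 1 - 1 = int n * v"
      by (elim dvdE)
    then show ?thesis using that[of u v] by simp
  qed
  have stepB: "B (Suc k) = B k * B 1 + A k * A 1" for k
    using kfib_add[of K "k * t" t] by (simp add: A_def B_def add.commute)
  \<comment> \<open>\<open>B k - int K * A k\<close> is the term of index k t - 1; at k t = 0 there
    is no such index, hence the case split.\<close>
  have stepA: "A (Suc k) = A k * B 1 + (B k - int K * A k) * A 1" for k
  proof (cases "k * t")
    case 0
    then have "Suc k * t = t" by simp
    then show ?thesis unfolding A_def B_def 0 \<open>Suc k * t = t\<close> by simp
  next
    case (Suc l)
    have "kfib K (Suc (l + t)) = kfib K (Suc l) * kfib K (Suc t) + kfib K l * kfib K t"
      by (rule kfib_add)
    then show ?thesis using Suc by (simp add: A_def B_def add.commute)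
  qed
  have "\<exists>u v. A k = int k * int n * x + (int n)\<^sup>2 * u \<and> B k = 1 + int k * int n * y + (int n)\<^sup>2 * v" for k
  proof (induction k)
    case 0
    then show ?case by (simp add: A_def B_def)
  next
    case (Suc k)
    then obtain u v where u: "A k = int k * int n * x + (int n)\<^sup>2 * u"
      and v: "B k = 1 + int k * int n * y + (int n)\<^sup>2 * v" by blast
    \<comment> \<open>The witnesses collect the terms divisible by n^2 in the expanded
      \<open>stepA\<close> and \<open>stepB\<close>.\<close>
    let ?u = "int k * x * y + u * B 1 + int k * y * x + v * A 1 - int K * (int k * x * x + u * A 1)"
    let ?v = "int k * y * y + v * B 1 + int k * x * x + u * A 1"
    have "A (Suc k) = int (Suc k) * int n * x + (int n)\<^sup>2 * ?u"
      unfolding stepA u v x y by (simp add: algebra_simps power2_eq_square)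
    moreover have "B (Suc k) = 1 + int (Suc k) * int n * y + (int n)\<^sup>2 * ?v"
      unfolding stepB u v x y by (simp add: algebra_simps power2_eq_square)
    ultimately show ?case by blast
  qed
  then obtain u v where u: "A p = int p * int n * x + (int n)\<^sup>2 * u"
      and v: "B p = 1 + int p * int n * y + (int n)\<^sup>2 * v" by blast
  \<comment> \<open>As p divides n, the second-order terms vanish modulo n p; the linear terms carry
    the factor n p already.\<close>
  have d: "int (n * p) dvd (int n)\<^sup>2"
    using \<open>p dvd n\<close> by (auto simp: power2_eq_square)
  have "int (n * p) dvd A p" unfolding u using d
    by (intro dvd_add) (auto simp: mult.commute mult.left_commute)
  moreover have "int (n * p) dvd B p - 1"
  proof -
    have "B p - 1 = int (n * p) * y + (int n)\<^sup>2 * v" unfolding v by (simp add: algebra_simps)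
    then show ?thesis using d by simp
  qed
  ultimately have "[A p = 0] (mod int (n * p))" "[B p = 1] (mod int (n * p))"
    by (auto simp: cong_0_iff cong_iff_dvd_diff)
  then have "[int (kfib K (t * p)) = int 0] (mod int (n * p))"
      "[int (kfib K (Suc (t * p))) = int 1] (mod int (n * p))"
    by (simp_all add: A_def B_def mult.commute)
  then show ?thesis
    unfolding is_kfib_period_iff cong_int_iff by simp
qed

lemma is_kfib_period_lift_power:
  assumes "is_kfib_period K n t" "p dvd n"
  shows "is_kfib_period K (n * p ^ e) (t * p ^ e)"
proof (induction e)
  case (Suc e)
  then show ?case
    using is_kfib_period_lift[of K "n * p ^ e" "t * p ^ e" p] assms(2) by (simp add: mult_ac)
qed (use assms in simp)

text \<open>Chinese remaindering over the pairwise coprime prime powers in m.\<close>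

lemma is_kfib_period_prime_powers:
  assumes "m > 0"
    and "\<And>p. p \<in> prime_factors m \<Longrightarrow> is_kfib_period K (p ^ multiplicity p m) t"
  shows "is_kfib_period K m t"
proof -
  have m: "m = (\<Prod>p\<in>prime_factors m. p ^ multiplicity p m)"
    using assms(1) by (simp add: prod_prime_factors)
  have cop: "\<forall>p\<in>prime_factors m. \<forall>q\<in>prime_factors m. p \<noteq> q \<longrightarrow>
      coprime (p ^ multiplicity p m) (q ^ multiplicity q m)"
    by (auto intro: primes_coprime)
  have "[kfib K (n + t) = kfib K n] (mod (\<Prod>p\<in>prime_factors m. p ^ multiplicity p m))" for n
    using assms(2) cop unfolding is_kfib_period_def by (intro coprime_cong_prod_nat) auto
  then show ?thesis unfolding is_kfib_period_def using m by simp
qed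

section \<open>Odd primes dividing K^2 + 4\<close>

text \<open>A double root K/2 gives the closed form (n + 1) (K/2)^n for the term of index n + 1; the
  factor 2^n clears denominators.\<close>

lemma kfib_double_root:
  assumes "int p dvd int K ^ 2 + 4"
  shows "[2 ^ n * int (kfib K (Suc n)) = int (Suc n) * int K ^ n] (mod int p)"
proof (induction n rule: less_induct)
  case (less n)
  consider "n = 0" | "n = 1" | l where "n = Suc (Suc l)"
    by (metis One_nat_def not0_implies_Suc)
  then show ?case
  proof cases
    case 3
    let ?a = "int (kfib K (Suc l))" and ?b = "int (kfib K (Suc (Suc l)))"
    have "[2 * int K * (2 ^ Suc l * ?b) + 4 * (2 ^ l * ?a)
        = 2 * int K * (int (Suc (Suc l)) * int K ^ Suc l) + 4 * (int (Suc l) * int K ^ l)] (mod int p)"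
      by (intro cong_add cong_scalar_left less) (auto simp: 3)
    also have "2 * int K * (2 ^ Suc l * ?b) + 4 * (2 ^ l * ?a) = 2 ^ n * int (kfib K (Suc n))"
      using 3 by (simp add: algebra_simps)
    \<comment> \<open>Splitting 2 (l + 2) = (l + 3) + (l + 1) isolates a multiple of K^2 +
      4.\<close>
    also have "2 * int K * (int (Suc (Suc l)) * int K ^ Suc l) + 4 * (int (Suc l) * int K ^ l)
        = int (Suc n) * int K ^ n + (int K ^ 2 + 4) * (int (Suc l) * int K ^ l)"
      using 3 by (simp add: algebra_simps power2_eq_square)
    also have "[\<dots> = int (Suc n) * int K ^ n] (mod int p)"
      using assms by (simp add: cong_iff_dvd_diff)
    finally show ?thesis .
  qed auto
qed

text \<open>Allows cancelling powers of 2 and of K modulo p: a prime dividing both K and K^2 + 4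
  would divide 4.\<close>

lemma ramified_prime_coprime:
  fixes p K :: nat
  assumes "prime p" "odd p" "p dvd K\<^sup>2 + 4"
  shows "int p dvd int K ^ 2 + 4" "coprime (int p) 2" "coprime (int p) (int K)"
proof -
  have "int p dvd int (K\<^sup>2 + 4)" using assms(3) by (simp only: int_dvd_int_iff)
  then show d: "int p dvd int K ^ 2 + 4" by simp
  show "coprime (int p) 2" using assms(2) by (simp add: coprime_commute)
  have "\<not> p dvd 2" using assms(1,2) primes_dvd_imp_eq two_is_prime_nat by blast
  then have "\<not> int p dvd 2" using int_dvd_int_iff[of p 2] by simp
  moreover have "prime (int p)" using assms(1) by simp
  ultimately have "\<not> int p dvd 2 ^ 2" using prime_dvd_power by blast
  moreover have "int p dvd 2 ^ 2" if "int p dvd int K"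
  proof -
    have "int p dvd int K ^ 2" using that by (simp add: power2_eq_square)
    then have "int p dvd (int K ^ 2 + 4) - int K ^ 2" using d by (rule dvd_diff[rotated])
    then show ?thesis by simp
  qed
  ultimately have "\<not> int p dvd int K" by blast
  then show "coprime (int p) (int K)" using \<open>prime (int p)\<close> prime_imp_coprime by blast
qed

text \<open>In the closed form the factor p of 4p kills the linear coefficient, and the factor 4
  works because (K/2)^2 = -1, so (K/2)^4 = 1.\<close>

lemma ramified_prime_period:
  assumes "prime p" "odd p" "p dvd K\<^sup>2 + 4"
  shows "is_kfib_period K p (4 * p)"
proof -
  note f = ramified_prime_coprime[OF assms]
  have p0: "p > 0" using assms(1) prime_gt_0_nat by blast
  let ?c = "\<lambda>a b. [a = b] (mod int p)"
  have "?c (2 ^ (4 * p - 1) * int (kfib K (Suc (4 * p - 1)))) (int (Suc (4 * p - 1)) * int K ^ (4 * p - 1))"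
    by (rule kfib_double_root[OF f(1)])
  moreover have "Suc (4 * p - 1) = 4 * p" using p0 by simp
  ultimately have "?c (2 ^ (4 * p - 1) * int (kfib K (4 * p))) (int (4 * p) * int K ^ (4 * p - 1))"
    by metis
  moreover have "?c (int (4 * p) * int K ^ (4 * p - 1)) 0" by (simp add: cong_0_iff)
  ultimately have "int p dvd 2 ^ (4 * p - 1) * int (kfib K (4 * p))"
    by (metis cong_0_iff cong_trans)
  then have "int p dvd int (kfib K (4 * p))"
    using f(2) by (simp add: coprime_dvd_mult_right_iff)
  then have 1: "[kfib K (4 * p) = 0] (mod p)" by (simp add: cong_0_iff)
  have "?c ((int K) ^ 4) (2 ^ 4)"
  proof -
    have "int K ^ 4 - 2 ^ 4 = (int K ^ 2 + 4) * (int K ^ 2 - 4)"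
      by (simp add: algebra_simps power2_eq_square power4_eq_xxxx)
    then show ?thesis using f(1) by (metis cong_iff_dvd_diff dvd_mult2)
  qed
  then have K: "?c (int K ^ (4 * p)) (2 ^ (4 * p))" by (simp add: power_mult cong_pow)
  have "?c (2 ^ (4 * p) * int (kfib K (Suc (4 * p)))) (int (Suc (4 * p)) * int K ^ (4 * p))"
    by (rule kfib_double_root[OF f(1)])
  also have "?c (int (Suc (4 * p)) * int K ^ (4 * p)) (1 * 2 ^ (4 * p))"
    using K by (intro cong_mult) (auto simp: cong_iff_dvd_diff)
  finally have "?c (2 ^ (4 * p) * int (kfib K (Suc (4 * p)))) (2 ^ (4 * p) * 1)" by simp
  moreover have "coprime (2 ^ (4 * p)) (int p)" using f(2) by (simp add: coprime_commute)
  ultimately have "?c (int (kfib K (Suc (4 * p)))) 1" using cong_mult_lcancel by blast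
  then have "?c (int (kfib K (Suc (4 * p)))) (int 1)" by simp
  then have "[kfib K (Suc (4 * p)) = 1] (mod p)" by (simp only: cong_int_iff)
  with 1 show ?thesis by (simp add: is_kfib_period_iff)
qed

text \<open>A zero at index t forces p to divide t; the next term being 1 then gives (K/2)^t = 1,
  and K/2 has order 4 because its square is -1.\<close>

lemma four_dvd_ramified_prime_period:
  assumes "prime p" "odd p" "p dvd K\<^sup>2 + 4" and per: "is_kfib_period K p t"
  shows "4 dvd t"
proof (cases t)
  case (Suc l)
  note f = ramified_prime_coprime[OF assms(1-3)]
  let ?c = "\<lambda>a b. [a = b] (mod int p)"
  have F: "?c (int (kfib K t)) (int 0)" "?c (int (kfib K (Suc t))) (int 1)"
    using per unfolding is_kfib_period_iff by (simp_all only: cong_int_iff)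
  have "?c (int t * int K ^ l) (2 ^ l * int (kfib K t))"
    using kfib_double_root[OF f(1), of l] Suc by (simp add: cong_sym)
  also have "?c (2 ^ l * int (kfib K t)) (2 ^ l * int 0)"
    by (intro cong_mult F cong_refl)
  finally have "int p dvd int t * int K ^ l" by (simp add: cong_0_iff)
  then have "int p dvd int t" using f(3) by (simp add: coprime_dvd_mult_left_iff)
  have "?c (2 ^ t * int 1) (2 ^ t * int (kfib K (Suc t)))"
    by (intro cong_mult cong_refl) (use F cong_sym in blast)
  also have "?c (2 ^ t * int (kfib K (Suc t))) (int (Suc t) * int K ^ t)"
    by (rule kfib_double_root[OF f(1)])
  also have "?c (int (Suc t) * int K ^ t) (1 * int K ^ t)"
    using \<open>int p dvd int t\<close> by (intro cong_mult cong_refl) (auto simp: cong_iff_dvd_diff)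
  finally have eq: "?c (2 ^ t) (int K ^ t)" by simp
  have K2: "?c (int K ^ 2) (- 4)" using f(1) by (simp add: cong_iff_dvd_diff)
  \<comment> \<open>For odd s, K^2 = -4 would give 4^s = -4^s, so p would divide a power of 2. This
    is used with s = t after squaring \<open>eq\<close>, then with s = t/2.\<close>
  have contra: False if "odd s" "?c (4 ^ s) ((int K ^ 2) ^ s)" for s
  proof -
    have "?c (4 ^ s) ((- 4) ^ s)" using that(2) cong_pow[OF K2] cong_trans by blast
    then have "?c (2 ^ (2 * s)) (- (2 ^ (2 * s)))" using that(1) by (simp add: power_mult)
    then have "int p dvd 2 ^ Suc (2 * s)" by (simp add: cong_iff_dvd_diff)
    moreover have "coprime (int p) (2 ^ Suc (2 * s))" using f(2) by (meson coprime_power_right_iff)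
    ultimately have "is_unit (int p)" by (meson coprime_common_divisor dvd_refl)
    then show False using assms(1) by auto
  qed
  have "even t"
  proof (rule ccontr)
    assume "odd t"
    moreover have "?c ((2 ^ t)^2) ((int K ^ t)^2)" using eq cong_pow by blast
    then have "?c (4 ^ t) ((int K ^ 2) ^ t)" by (simp add: power_mult[symmetric] mult.commute power2_eq_square flip: power_mult_distrib)
    ultimately show False using contra by blast
  qed
  then obtain s where s: "t = 2 * s" by blast
  then have "?c (4 ^ s) ((int K ^ 2) ^ s)" using eq by (simp add: power_mult)
  then have "even s" using contra by blast
  then show ?thesis using s by auto
qed simp

section \<open>Odd primes not dividing K^2 + 4\<close>

text \<open>From i C(p^2, i) = p^2 C(p^2 - 1, i - 1): if p did not divide C(p^2, i), then p^2 would
  divide i.\<close>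

lemma prime_dvd_choose_square:
  fixes p i :: nat
  assumes "prime p" "0 < i" "i < p\<^sup>2"
  shows "p dvd p\<^sup>2 choose i"
proof (rule ccontr)
  assume "\<not> p dvd p\<^sup>2 choose i"
  then have "coprime (p\<^sup>2) (p\<^sup>2 choose i)"
    using assms(1) prime_imp_coprime by (simp)
  moreover have "p\<^sup>2 dvd i * (p\<^sup>2 choose i)"
    using assms(2,3) by (metis times_binomial_minus1_eq dvd_triv_left)
  ultimately have "p\<^sup>2 dvd i" by (simp add: coprime_dvd_mult_left_iff)
  then show False using assms(2,3) by (simp add: nat_dvd_not_less)
qed

text \<open>Frobenius applied twice, with arbitrary coefficients so that it covers both sums of
  \<open>kfib_binomial_sums\<close>.\<close>

lemma binomial_sum_prime_square_cong:
  fixes p :: nat and c :: "nat \<Rightarrow> int"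
  assumes "prime p"
  shows "[(\<Sum>i\<le>p\<^sup>2. int (p\<^sup>2 choose i) * c i) = c 0 + c (p\<^sup>2)] (mod int p)"
proof -
  have pos: "p\<^sup>2 > 0" using assms prime_gt_0_nat by simp
  have split: "{..p\<^sup>2} = insert 0 (insert (p\<^sup>2) {0<..<p\<^sup>2})" using pos by auto
  have "int p dvd (\<Sum>i\<in>{0<..<p\<^sup>2}. int (p\<^sup>2 choose i) * c i)"
    using prime_dvd_choose_square[OF assms] by (intro dvd_sum dvd_mult2) auto
  then show ?thesis unfolding split using pos by (simp add: cong_iff_dvd_diff)
qed

text \<open>Binet's formulas for the sequence and its Lucas companion, cleared of denominators.
  Multiplying by K + s and K - s mixes sum and difference, so both are proved in one
  induction.\<close>

lemma kfib_binet:
  fixes K :: nat and s :: real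
  assumes "s\<^sup>2 = real K ^ 2 + 4"
  shows "2 ^ n * real (kfib K n) * s = (real K + s) ^ n - (real K - s) ^ n"
    and "2 ^ n * (2 * real (kfib K (Suc n)) - real K * real (kfib K n)) = (real K + s) ^ n + (real K - s) ^ n"
proof -
  have "2 ^ n * real (kfib K n) * s = (real K + s) ^ n - (real K - s) ^ n \<and>
    2 ^ n * (2 * real (kfib K (Suc n)) - real K * real (kfib K n)) = (real K + s) ^ n + (real K - s) ^ n"
  proof (induction n)
    case (Suc n)
    let ?a = "real (kfib K n)" and ?b = "real (kfib K (Suc n))"
    define u where "u = (real K + s) ^ n"
    define v where "v = (real K - s) ^ n"
    define w where "w = (2::real) ^ n"
    have IH: "w * ?a * s = u - v" "w * (2 * ?b - real K * ?a) = u + v"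
      using Suc by (simp_all add: u_def v_def w_def)
    have "(real K + s) * u - (real K - s) * v = real K * (u - v) + s * (u + v)"
      by (simp add: algebra_simps)
    also have "\<dots> = 2 * w * ?b * s"
      unfolding IH[symmetric] by (simp add: algebra_simps)
    finally have 1: "2 * w * ?b * s = (real K + s) * u - (real K - s) * v" by simp
    have "(real K + s) * u + (real K - s) * v = real K * (u + v) + s * (u - v)"
      by (simp add: algebra_simps)
    also have "\<dots> = real K * (w * (2 * ?b - real K * ?a)) + w * ?a * s\<^sup>2"
      unfolding IH[symmetric] by (simp add: algebra_simps power2_eq_square)
    also have "\<dots> = 2 * w * (2 * (real K * ?b + ?a) - real K * ?b)"
      unfolding assms by (simp add: algebra_simps power2_eq_square)
    finally have 2: "2 * w * (2 * (real K * ?b + ?a) - real K * ?b) = (real K + s) * u + (real K - s) * v"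
      by simp
    show ?case using 1 2 by (simp add: u_def v_def w_def)
  qed simp
  then show "2 ^ n * real (kfib K n) * s = (real K + s) ^ n - (real K - s) ^ n"
    and "2 ^ n * (2 * real (kfib K (Suc n)) - real K * real (kfib K n)) = (real K + s) ^ n + (real K - s) ^ n"
    by auto
qed

text \<open>Binomial expansion of Binet's formulas: odd powers of s survive in the difference, even
  ones in the sum. Zero coefficients are kept so that the index runs over all i \<le> n, as the
  congruence for binomial sums requires.\<close>

lemma kfib_binomial_sums:
  fixes K :: nat
  defines "D \<equiv> int K ^ 2 + 4"
  shows "2 ^ n * int (kfib K n) =
      (\<Sum>i\<le>n. int (n choose i) * (int K ^ (n - i) * (if odd i then 2 * D ^ (i div 2) else 0)))"
    and "2 ^ n * (2 * int (kfib K (Suc n)) - int K * int (kfib K n)) =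
      (\<Sum>i\<le>n. int (n choose i) * (int K ^ (n - i) * (if even i then 2 * D ^ (i div 2) else 0)))"
proof -
  define s where "s = sqrt (of_int D)"
  have Dpos: "of_int D > (0::real)" unfolding D_def by (simp add: add_nonneg_pos)
  then have s2: "s\<^sup>2 = of_int D" and s0: "s \<noteq> 0" unfolding s_def by auto
  have pow: "s ^ i = (if odd i then s * of_int D ^ (i div 2) else of_int D ^ (i div 2))" for i
  proof -
    have "s ^ (2 * (i div 2)) = of_int D ^ (i div 2)" by (simp add: power_mult s2)
    then show ?thesis
      by (metis even_two_times_div_two odd_two_times_div_two_succ power_Suc Suc_eq_plus1)
  qed
  have s2': "s\<^sup>2 = real K ^ 2 + 4" using s2 by (simp add: D_def)
  have e1: "(real K + s) ^ n = (\<Sum>i\<le>n. real (n choose i) * (s ^ i * real K ^ (n - i)))"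
    using binomial_ring[of s "real K" n] by (simp add: add.commute mult.assoc)
  have e2: "(real K - s) ^ n = (\<Sum>i\<le>n. real (n choose i) * ((- s) ^ i * real K ^ (n - i)))"
    using binomial_ring[of "- s" "real K" n] by (simp add: mult.assoc)
  have "2 ^ n * real (kfib K n) * s = (\<Sum>i\<le>n. real (n choose i) * (s ^ i * real K ^ (n - i)) - real (n choose i) * ((- s) ^ i * real K ^ (n - i)))"
    unfolding kfib_binet(1)[OF s2'] e1 e2 by (rule sum_subtractf[symmetric])
  also have "\<dots> = (\<Sum>i\<le>n. real (n choose i) * (real K ^ (n - i) * (if odd i then 2 * of_int D ^ (i div 2) else 0)) * s)"
    by (rule sum.cong) (auto simp: pow)
  also have "\<dots> = (\<Sum>i\<le>n. real (n choose i) * (real K ^ (n - i) * (if odd i then 2 * of_int D ^ (i div 2) else 0))) * s"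
    by (rule sum_distrib_right[symmetric])
  finally have "2 ^ n * real (kfib K n) = (\<Sum>i\<le>n. real (n choose i) * (real K ^ (n - i) * (if odd i then 2 * of_int D ^ (i div 2) else 0)))"
    using s0 by simp
  also have "\<dots> = of_int (\<Sum>i\<le>n. int (n choose i) * (int K ^ (n - i) * (if odd i then 2 * D ^ (i div 2) else 0)))"
    by (simp add: if_distrib cong: if_cong)
  finally have "real_of_int (2 ^ n * int (kfib K n)) = of_int (\<Sum>i\<le>n. int (n choose i) * (int K ^ (n - i) * (if odd i then 2 * D ^ (i div 2) else 0)))"
    by simp
  then show "2 ^ n * int (kfib K n) =
      (\<Sum>i\<le>n. int (n choose i) * (int K ^ (n - i) * (if odd i then 2 * D ^ (i div 2) else 0)))"
    by (simp only: of_int_eq_iff)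
  have "2 ^ n * (2 * real (kfib K (Suc n)) - real K * real (kfib K n)) = (\<Sum>i\<le>n. real (n choose i) * (s ^ i * real K ^ (n - i)) + real (n choose i) * ((- s) ^ i * real K ^ (n - i)))"
    unfolding kfib_binet(2)[OF s2'] e1 e2 by (rule sum.distrib[symmetric])
  also have "\<dots> = (\<Sum>i\<le>n. real (n choose i) * (real K ^ (n - i) * (if even i then 2 * of_int D ^ (i div 2) else 0)))"
    by (rule sum.cong) (auto simp: pow)
  also have "\<dots> = of_int (\<Sum>i\<le>n. int (n choose i) * (int K ^ (n - i) * (if even i then 2 * D ^ (i div 2) else 0)))"
    by (simp add: if_distrib cong: if_cong)
  finally have "real_of_int (2 ^ n * (2 * int (kfib K (Suc n)) - int K * int (kfib K n))) = of_int (\<Sum>i\<le>n. int (n choose i) * (int K ^ (n - i) * (if even i then 2 * D ^ (i div 2) else 0)))"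
    by simp
  then show "2 ^ n * (2 * int (kfib K (Suc n)) - int K * int (kfib K n)) =
      (\<Sum>i\<le>n. int (n choose i) * (int K ^ (n - i) * (if even i then 2 * D ^ (i div 2) else 0)))"
    by (simp only: of_int_eq_iff)
qed

lemma fermat_square:
  fixes a p :: nat
  assumes "prime p"
  shows "[int a ^ p\<^sup>2 = int a] (mod int p)"
proof -
  have fermat: "[b ^ p = b] (mod p)" for b :: nat
  proof (cases "p dvd b")
    case True
    then have "p dvd b ^ p" using assms prime_gt_0_nat by (meson dvd_power dvd_trans)
    then show ?thesis using True by (simp add: cong_def)
  next
    case False
    have "[b * b ^ (p - 1) = b * 1] (mod p)"
      using fermat_theorem[OF assms False] by (intro cong_mult cong_refl)
    then show ?thesis using assms prime_gt_0_nat by (simp add: power_eq_if)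
  qed
  have "a ^ p\<^sup>2 = (a ^ p) ^ p" by (simp add: power_mult power2_eq_square)
  then have "[a ^ p\<^sup>2 = a] (mod p)" using fermat cong_trans by metis
  then show ?thesis by (simp flip: cong_int_iff)
qed

text \<open>Passing from \<open>p\<close> to \<open>p\<^sup>2\<close> treats split and inert primes alike: Frobenius applied twice
  fixes both roots, because \<open>D\<close> to the power \<open>(p\<^sup>2 - 1) / 2\<close> is 1 modulo \<open>p\<close>.\<close>

lemma unramified_prime_period:
  assumes "prime p" "odd p" "\<not> p dvd K\<^sup>2 + 4"
  shows "is_kfib_period K p (p\<^sup>2 - 1)"
proof -
  let ?c = "\<lambda>a b. [a = b] (mod int p)"
  let ?n = "p\<^sup>2"
  define D where "D = int K ^ 2 + 4"
  have n: "odd ?n" "?n > 0" using assms prime_gt_0_nat by auto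
  have cop2: "coprime 2 (int p)" using assms(2) by simp
  \<comment> \<open>Since p^2 is odd, the left side is (p^2 - 1)/2, a multiple of p - 1, so Fermat
    applies to D.\<close>
  have "?n div 2 = (p - 1) * ((p + 1) div 2)"
    using assms(2) by (elim oddE) (simp add: power2_eq_square algebra_simps)
  moreover have "[(K\<^sup>2 + 4) ^ (p - 1) = 1] (mod p)"
    using fermat_theorem[OF assms(1,3)] .
  ultimately have "[(K\<^sup>2 + 4) ^ (?n div 2) = 1] (mod p)"
    by (metis cong_pow power_mult power_one)
  then have "[int ((K\<^sup>2 + 4) ^ (?n div 2)) = int 1] (mod int p)"
    by (simp only: cong_int_iff)
  then have D1: "?c (D ^ (?n div 2)) 1" by (simp add: D_def)
  have two: "?c (2 ^ ?n) 2" using fermat_square[OF assms(1), of 2] by simp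
  have A: "?c (2 * int (kfib K ?n)) (2 * 1)"
  proof -
    have "?c (2 * int (kfib K ?n)) (2 ^ ?n * int (kfib K ?n))"
      using two by (intro cong_mult cong_refl) (rule cong_sym)
    \<comment> \<open>Only the end terms remain: i = 0 has coefficient 0, and i = p^2 gives 2
      D^((p^2-1)/2). In \<open>B\<close> the roles of the two ends are exchanged.\<close>
    also have "?c (2 ^ ?n * int (kfib K ?n)) (int K ^ (?n - 0) * (if odd (0::nat) then 2 * D ^ (0 div 2) else 0)
        + int K ^ (?n - ?n) * (if odd ?n then 2 * D ^ (?n div 2) else 0))"
      unfolding kfib_binomial_sums(1) D_def by (rule binomial_sum_prime_square_cong[OF assms(1)])
    also have "int K ^ (?n - 0) * (if odd (0::nat) then 2 * D ^ (0 div 2) else 0)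
        + int K ^ (?n - ?n) * (if odd ?n then 2 * D ^ (?n div 2) else 0) = 2 * D ^ (?n div 2)"
      using n by simp
    also have "?c \<dots> (2 * 1)" using D1 by (intro cong_mult cong_refl)
    finally show ?thesis .
  qed
  then have A': "?c (int (kfib K ?n)) 1" using cop2 cong_mult_lcancel by blast
  have B: "?c (2 * (2 * int (kfib K (Suc ?n)) - int K * int (kfib K ?n))) (2 * int K)"
  proof -
    have "?c (2 * (2 * int (kfib K (Suc ?n)) - int K * int (kfib K ?n)))
        (2 ^ ?n * (2 * int (kfib K (Suc ?n)) - int K * int (kfib K ?n)))"
      using two by (intro cong_mult cong_refl) (rule cong_sym)
    also have "?c (2 ^ ?n * (2 * int (kfib K (Suc ?n)) - int K * int (kfib K ?n)))
       (int K ^ (?n - 0) * (if even (0::nat) then 2 * D ^ (0 div 2) else 0)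
        + int K ^ (?n - ?n) * (if even ?n then 2 * D ^ (?n div 2) else 0))"
      unfolding kfib_binomial_sums(2) D_def by (rule binomial_sum_prime_square_cong[OF assms(1)])
    also have "int K ^ (?n - 0) * (if even (0::nat) then 2 * D ^ (0 div 2) else 0)
        + int K ^ (?n - ?n) * (if even ?n then 2 * D ^ (?n div 2) else 0) = 2 * int K ^ ?n"
      using n by simp
    also have "?c \<dots> (2 * int K)" using fermat_square[OF assms(1)] by (intro cong_mult cong_refl)
    finally show ?thesis .
  qed
  then have "?c (2 * int (kfib K (Suc ?n)) - int K * int (kfib K ?n)) (int K)"
    using cop2 cong_mult_lcancel by blast
  then have "?c (2 * int (kfib K (Suc ?n)) - int K * int (kfib K ?n) + int K * int (kfib K ?n))
      (int K + int K * 1)"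
    using A' by (intro cong_add cong_mult cong_refl)
  then have "?c (2 * int (kfib K (Suc ?n))) (2 * int K)" by simp
  then have B': "?c (int (kfib K (Suc ?n))) (int K)" using cop2 cong_mult_lcancel by blast
  \<comment> \<open>The terms at p^2 and p^2 + 1 are 1 and K; running the recurrence backwards gives
    0 at t = p^2 - 1.\<close>
  obtain t where t: "?n = Suc t" using n(2) gr0_implies_Suc by blast
  have "[int K * int (kfib K (Suc t)) + int (kfib K t) = int K * 1 + 0] (mod int p)"
    using B' t by simp
  moreover have "[int K * int (kfib K (Suc t)) = int K * 1] (mod int p)"
    using A' t by (intro cong_mult cong_refl) simp
  ultimately have "[int K * int (kfib K (Suc t)) + int (kfib K t) - int K * int (kfib K (Suc t))
      = int K * 1 + 0 - int K * 1] (mod int p)"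
    by (rule cong_diff)
  then have "[int (kfib K t) = 0] (mod int p)" by simp
  then have "[int (kfib K t) = int 0] (mod int p)" "[int (kfib K (Suc t)) = int 1] (mod int p)"
    using A' t by simp_all
  then show ?thesis unfolding is_kfib_period_iff cong_int_iff using t by simp
qed

section \<open>An explicit period for every modulus\<close>

text \<open>Not the least period in general; what matters is which primes divide it. For even K its
  value at 2 is 8, a multiple of the period 2.\<close>

definition prime_period :: "nat \<Rightarrow> nat \<Rightarrow> nat" where
  "prime_period K p = (if p dvd K\<^sup>2 + 4 then 4 * p else p\<^sup>2 - 1)"

text \<open>The terms of index 2 and 3 are K and K^2 + 1. Lifting from 4 instead of 2 gives the
  period 2^(e-1) modulo 2^e for e \<ge> 2.\<close>

lemma is_kfib_period_4:
  assumes "4 dvd K"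
  shows "is_kfib_period K 4 2"
proof -
  have "[K * K + 1 = 0 + 1] (mod 4)"
    using assms by (intro cong_add cong_refl) (simp add: cong_0_iff)
  then show ?thesis using assms by (simp add: is_kfib_period_iff cong_0_iff numeral_2_eq_2)
qed

lemma is_kfib_period_prime_power:
  assumes "4 dvd K" "prime p" "e > 0"
  shows "is_kfib_period K (p ^ e) (prime_period K p * p ^ (e - 1))"
proof -
  have "is_kfib_period K p (prime_period K p)"
  proof (cases "p = 2")
    case True
    have "2 dvd K\<^sup>2 + 4" using assms(1) by auto
    then have "2 dvd prime_period K p" using True by (simp add: prime_period_def)
    moreover have "is_kfib_period K p 2"
      using is_kfib_period_dvd_modulus[OF is_kfib_period_4[OF assms(1)], of p] True by simp
    ultimately show ?thesis using is_kfib_period_dvd by blast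
  next
    case False
    then have "odd p" using assms(2) primes_dvd_imp_eq two_is_prime_nat by blast
    then show ?thesis
      using ramified_prime_period unramified_prime_period assms(2)
      by (simp add: prime_period_def)
  qed
  then have "is_kfib_period K (p * p ^ (e - 1)) (prime_period K p * p ^ (e - 1))"
    by (rule is_kfib_period_lift_power) simp
  then show ?thesis using assms(3) by (simp add: power_eq_if)
qed

lemma prime_period_pos: "prime p \<Longrightarrow> prime_period K p > 0"
  using one_less_power[of p 2] prime_gt_1_nat[of p] by (auto simp: prime_period_def)

text \<open>The product serves as a crude common multiple; it is precise enough to count the
  exponent of one well-chosen prime.\<close>

lemma is_kfib_period_prod:
  assumes "4 dvd K" "m > 0"
  shows "is_kfib_period K m (\<Prod>p\<in>prime_factors m. prime_period K p * p ^ (multiplicity p m - 1))"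
proof (rule is_kfib_period_prime_powers[OF assms(2)])
  fix p assume p: "p \<in> prime_factors m"
  then have "is_kfib_period K (p ^ multiplicity p m) (prime_period K p * p ^ (multiplicity p m - 1))"
    using assms(1) by (intro is_kfib_period_prime_power) (auto simp: prime_factors_multiplicity)
  then show "is_kfib_period K (p ^ multiplicity p m)
      (\<Prod>p\<in>prime_factors m. prime_period K p * p ^ (multiplicity p m - 1))"
    by (rule is_kfib_period_dvd) (use p in \<open>auto intro!: dvd_prodI\<close>)
qed

lemma prod_prime_period_pos:
  "(\<Prod>p\<in>prime_factors m. prime_period K p * p ^ (multiplicity p m - 1)) > 0"
  by (intro prod_pos) (auto simp: prime_period_pos in_prime_factors_imp_prime prime_gt_0_nat)

section \<open>Prime factors and 2-adic valuation of a fixed point\<close>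

text \<open>Here q is odd because K^2 + 4 is even. If q divides 4p, then q is 2 or p. If q divides
  (p - 1)(p + 1) with p \<le> q, size leaves only q = p + 1, excluded by parity, or q = p, which
  does not divide p + 1.\<close>

lemma not_dvd_prime_period:
  assumes "4 dvd K" "prime p" "prime q" "\<not> q dvd K\<^sup>2 + 4"
    and le: "\<not> p dvd K\<^sup>2 + 4 \<Longrightarrow> p \<le> q"
  shows "\<not> q dvd prime_period K p"
proof
  assume dvd: "q dvd prime_period K p"
  have even: "2 dvd K\<^sup>2 + 4" using assms(1) by auto
  have "q \<noteq> 2" using even assms(4) by blast
  then have q: "odd q" using assms(3) primes_dvd_imp_eq two_is_prime_nat by blast
  show False
  proof (cases "p dvd K\<^sup>2 + 4")
    case True
    then have "q dvd 2 * 2 * p" using dvd by (simp add: prime_period_def)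
    then have "q dvd 2 \<or> q dvd p" using assms(3) by (metis prime_dvd_mult_iff)
    then have "q = 2 \<or> q = p" using assms(2,3) primes_dvd_imp_eq two_is_prime_nat by blast
    then show False using \<open>q \<noteq> 2\<close> True assms(4) by blast
  next
    case False
    have "p \<noteq> 2" using even False by blast
    then have p: "odd p" using assms(2) primes_dvd_imp_eq two_is_prime_nat by blast
    have "prime_period K p = (p - 1) * (p + 1)"
      using False by (simp add: prime_period_def power2_eq_square algebra_simps)
    then consider "q dvd p - 1" | "q dvd p + 1" using dvd assms(3) prime_dvd_mult_iff by metis
    then show False
    proof cases
      case 1
      then have "q \<le> p - 1" using assms(2) prime_gt_1_nat by (intro dvd_imp_le) auto
      then show False using le[OF False] prime_gt_1_nat[OF assms(2)] by linarith
    next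
      case 2
      then have "q \<le> p + 1" by (intro dvd_imp_le) auto
      moreover have "q \<noteq> p + 1" using p q by auto
      ultimately have "q = p" using le[OF False] by linarith
      then show False using 2 assms(3) dvd_add_right_iff[of p p 1] by simp
    qed
  qed
qed

lemma fixed_point_prime_dvd:
  assumes "4 dvd K" "m > 1" "kfib_period K m = m" "prime q" "q dvd m"
  shows "q dvd K\<^sup>2 + 4"
proof (rule ccontr)
  assume "\<not> q dvd K\<^sup>2 + 4"
  define S where "S = {q \<in> prime_factors m. \<not> q dvd K\<^sup>2 + 4}"
  have "finite S" "S \<noteq> {}"
    using assms \<open>\<not> q dvd K\<^sup>2 + 4\<close> by (auto simp: S_def in_prime_factors_iff)
  \<comment> \<open>Maximality supplies the bound that \<open>not_dvd_prime_period\<close> asks for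
    at every prime factor of m not dividing K^2 + 4.\<close>
  define x where "x = Max S"
  have xS: "x \<in> S" and max: "\<And>y. y \<in> S \<Longrightarrow> y \<le> x"
    using \<open>finite S\<close> \<open>S \<noteq> {}\<close> by (auto simp: x_def)
  define e where "e = multiplicity x m"
  let ?f = "\<lambda>p. prime_period K p * p ^ (multiplicity p m - 1)"
  have x: "prime x" "x \<in> prime_factors m" "\<not> x dvd K\<^sup>2 + 4" "e > 0"
    using xS by (auto simp: S_def e_def prime_factors_multiplicity)
  have nd: "\<not> x dvd prime_period K p" if "p \<in> prime_factors m" for p
    using that assms(1) x max by (intro not_dvd_prime_period) (auto simp: S_def)
  \<comment> \<open>\<open>R\<close> is the product of the lifted periods with the lifting factor
    x^(e-1) removed, hence prime to x.\<close>
  define R where "R = prime_period K x * (\<Prod>p\<in>prime_factors m - {x}. ?f p)"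
  have "\<not> x dvd ?f p" if "p \<in> prime_factors m - {x}" for p
  proof -
    have "\<not> x dvd p" using that x(1) primes_dvd_imp_eq by blast
    then have "\<not> x dvd p ^ (multiplicity p m - 1)" using x(1) prime_dvd_power by blast
    then show ?thesis using that nd[of p] x(1) by (simp add: prime_dvd_mult_iff)
  qed
  then have "\<not> x dvd (\<Prod>p\<in>prime_factors m - {x}. ?f p)"
    using x(1) by (subst prime_dvd_prod_iff) auto
  then have R: "\<not> x dvd R" using nd[OF x(2)] x(1) by (simp add: R_def prime_dvd_mult_iff)
  have "m dvd (\<Prod>p\<in>prime_factors m. ?f p)"
    using kfib_period_dvd[OF is_kfib_period_prod[of K m] prod_prime_period_pos] assms by simp
  also have "\<dots> = x ^ (e - 1) * R"
    using x(2) by (subst prod.remove[of _ x]) (auto simp: R_def e_def)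
  \<comment> \<open>The fixed point m contains x^e, but the product contains only x^(e-1).\<close>
  finally have "x ^ e dvd x ^ (e - 1) * R"
    using multiplicity_dvd dvd_trans e_def by blast
  then have "x ^ (e - 1) * x dvd x ^ (e - 1) * R"
    using x(4) by (cases e) (simp_all add: mult.commute)
  then have "x dvd R" using x(1) by (simp add: prime_gt_0_nat)
  with R show False by blast
qed

text \<open>If 8 divides m, then h = m/2 is a multiple of 2^(e-1), a period modulo 2^e, and of 4
  p^e, a period modulo p^e for odd p; so h is a period smaller than m.\<close>

lemma not_eight_dvd_fixed_point:
  assumes "4 dvd K" "m > 1" "kfib_period K m = m"
  shows "\<not> 8 dvd m"
proof
  assume "8 dvd m"
  then obtain h where h: "m = 2 * h" "4 dvd h" by (auto elim: dvdE)
  have h0: "h > 0" using assms(2) h by simp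
  have "is_kfib_period K m h"
  proof (rule is_kfib_period_prime_powers)
    show "m > 0" using assms(2) by simp
    fix p assume "p \<in> prime_factors m"
    then have p: "prime p" "p dvd m" by auto
    define e where "e = multiplicity p m"
    have ed: "p ^ e dvd m" by (simp add: e_def multiplicity_dvd)
    have e0: "e > 0" using \<open>p \<in> prime_factors m\<close> by (simp add: e_def prime_factors_multiplicity)
    show "is_kfib_period K (p ^ multiplicity p m) h"
    proof (cases "p = 2")
      case True
      have "2 ^ 2 dvd m" using h by auto
      then have "e \<ge> 2" using True assms(2) by (simp add: e_def multiplicity_geI)
      then obtain d where d: "e = d + 2" using le_Suc_ex add.commute by metis
      have "is_kfib_period K (4 * 2 ^ d) (2 * 2 ^ d)"
        by (rule is_kfib_period_lift_power[OF is_kfib_period_4[OF assms(1)]]) simp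
      moreover have "2 * 2 ^ d dvd h" using ed True h d by (simp add: power_add)
      ultimately have "is_kfib_period K (4 * 2 ^ d) h" using is_kfib_period_dvd by blast
      moreover have "p ^ multiplicity p m = 4 * 2 ^ d"
        unfolding e_def[symmetric] unfolding d True by (simp add: power_add)
      ultimately show ?thesis by simp
    next
      case False
      then have odd: "coprime 2 p" using p(1) primes_coprime two_is_prime_nat by blast
      have "prime_period K p = 4 * p"
        using fixed_point_prime_dvd[OF assms p] by (simp add: prime_period_def)
      then have "is_kfib_period K (p ^ e) (4 * p * p ^ (e - 1))"
        using is_kfib_period_prime_power[OF assms(1) p(1) e0] by simp
      then have per: "is_kfib_period K (p ^ e) (4 * p ^ e)"
        using e0 by (simp add: power_eq_if mult.assoc)
      have "coprime (p ^ e) 2" using odd by (simp add: coprime_commute)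
      then have "p ^ e dvd h" using ed h by (simp add: coprime_dvd_mult_right_iff)
      moreover have "coprime (2 ^ 2) (p ^ e)" using odd by (meson coprime_power_left_iff coprime_power_right_iff)
      ultimately have "4 * p ^ e dvd h" using h(2) by (simp add: divides_mult)
      then show ?thesis using per is_kfib_period_dvd e_def by blast
    qed
  qed
  then have "m dvd h" using kfib_period_dvd h0 assms(3) by metis
  then show False using h h0 by (auto dest: dvd_imp_le)
qed

lemma fixed_point_two_or_four_dvd:
  assumes "4 dvd K" "m > 1" "kfib_period K m = m"
  shows "m = 2 \<or> 4 dvd m"
proof (rule ccontr)
  assume "\<not> (m = 2 \<or> 4 dvd m)"
  then have ne: "m \<noteq> 2" "\<not> 4 dvd m" by auto
  have per: "is_kfib_period K m m"
    using kfib_period_is_period(2)[OF is_kfib_period_prod[of K m] prod_prime_period_pos] assms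
    by simp
  \<comment> \<open>An odd prime factor divides K^2 + 4 and so forces 4 to divide every period, in
    particular m; thus m is a power of 2 here.\<close>
  have two: "p = 2" if "prime p" "p dvd m" for p
  proof (rule ccontr)
    assume "p \<noteq> 2"
    then have "odd p" using that(1) primes_dvd_imp_eq two_is_prime_nat by blast
    then have "4 dvd m"
      using four_dvd_ramified_prime_period that fixed_point_prime_dvd[OF assms that]
        is_kfib_period_dvd_modulus[OF per that(2)] by blast
    with ne show False by blast
  qed
  obtain p where "prime p" "p dvd m" using assms(2) prime_factor_nat by (metis less_irrefl)
  with two obtain h where h: "m = 2 * h" by (metis dvdE)
  show False
  proof (cases "h = 1")
    case False
    then obtain p where "prime p" "p dvd h" using prime_factor_nat by blast
    then have "2 dvd h" using two h by (metis dvd_mult)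
    then show False using ne h by auto
  qed (use ne h in auto)
qed

section \<open>From the prime factors to the shape of m\<close>

theorem theorem3p8:
  fixes K m r :: nat and p a :: "nat \<Rightarrow> nat"
  assumes "K \<ge> 1" and "[K = 0] (mod 4)"
    and "r \<ge> 1"
    and "\<And>i. i \<in> {1..r} \<Longrightarrow> prime (p i)"
    and "\<And>i. i \<in> {1..r} \<Longrightarrow> a i \<ge> 1"
    and "inj_on p {1..r}"
    and "K^2 + 4 = (\<Prod>i=1..r. p i ^ a i)"
    and "p 1 ^ a 1 = 2 ^ 2"
    and "m > 1" and "kfib_period K m = m"
  shows "m = 2 \<or> (\<exists>j :: nat \<Rightarrow> nat. m = 4 * (\<Prod>i=2..r. p i ^ j i))"
proof (cases "m = 2")
  case False
  have K: "4 dvd K" using assms(2) by (simp add: cong_0_iff)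
  note fp = K assms(9,10)
  obtain n where n: "m = 4 * n"
    using fixed_point_two_or_four_dvd[OF fp] False by blast
  have "odd n" using not_eight_dvd_fixed_point[OF fp] n by auto
  have n0: "n > 0" using n assms(9) by simp
  have p1: "p 1 = 2"
  proof -
    have "prime (p 1)" using assms(3,4) by simp
    moreover have "p 1 dvd 2 ^ 2"
      using assms(3,5,8) by (metis atLeastAtMost_iff dvd_power le_refl less_le_trans zero_less_one)
    ultimately show ?thesis using prime_dvd_power primes_dvd_imp_eq two_is_prime_nat by blast
  qed
  have sub: "prime_factors n \<subseteq> p ` {2..r}"
  proof
    fix q assume "q \<in> prime_factors n"
    then have q: "prime q" "q dvd n" by auto
    then have "q dvd K\<^sup>2 + 4" using fixed_point_prime_dvd[OF fp q(1)] n by simp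
    then obtain i where i: "i \<in> {1..r}" "q dvd p i ^ a i"
      using assms(7) q(1) by (auto simp: prime_dvd_prod_iff)
    then have "q = p i" using q(1) assms(4) prime_dvd_power primes_dvd_imp_eq by blast
    \<comment> \<open>The cofactor n is odd, so its prime factors avoid p_1 = 2.\<close>
    moreover have "i \<noteq> 1" using \<open>odd n\<close> q(2) calculation p1 by auto
    ultimately show "q \<in> p ` {2..r}" using i(1) by auto
  qed
  have inj: "inj_on p {2..r}" using assms(6) by (rule inj_on_subset) auto
  have "n = (\<Prod>q\<in>prime_factors n. q ^ multiplicity q n)"
    using n0 by (simp add: prod_prime_factors)
  also have "\<dots> = (\<Prod>q\<in>p ` {2..r}. q ^ multiplicity q n)"
  proof (rule prod.mono_neutral_left[OF _ sub])
    \<comment> \<open>Primes p_i not dividing n have multiplicity 0 and contribute 1.\<close>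
    show "\<forall>q\<in>p ` {2..r} - prime_factors n. q ^ multiplicity q n = 1"
      using assms(4) by (auto simp: prime_factors_multiplicity)
  qed simp
  also have "\<dots> = (\<Prod>i=2..r. p i ^ multiplicity (p i) n)"
    by (simp add: prod.reindex[OF inj])
  finally show ?thesis using n by (intro disjI2 exI[of _ "\<lambda>i. multiplicity (p i) n"]) simp
qed simp

end
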